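(* Let $G$ be a compact group which is not trivial ($G\neq\{e\}$). Then, for any noise law $\mu=(\mu_k)_{k\in-\mathbf N}$ (a sequence of Borel probability measures on $G$), the case (C0) never occurs for the equation $\eta_k=\eta_{k-1}\cdot\xi_k$, $k\in-\mathbf N$, with noise law $\mu$; here (C0) is the case in which uniqueness in law holds and there exists a strong solution.
   Context: $-\mathbf N=\{0,-1,-2,\dots\}$; $e$ is the unit of $G$. On $G^{-\mathbf N}$ let $\eta=(\eta_k)_{k\in-\mathbf N}$ be the coordinate process, and set $\xi_k=(\eta_{k-1})^{-1}\cdot\eta_k$ for $k\in-\mathbf N$. Let $\mathcal F^\eta_k=\sigma(\eta_k,\eta_{k-1},\dots)$ and $\mathcal F^\xi_k=\sigma(\xi_k,\xi_{k-1},\dots)$. A solution with noise law $\mu$ is a probability measure $\mathbf P$ on $G^{-\mathbf N}$ such that, for every $k\in-\mathbf N$, under $\mathbf P$: (i) $\xi_k$ is independent of $\mathcal F^\eta_{k-1}$; (ii) $\xi_k$ has law $\mu_k$. The set of all solutions is denoted $\mathcal P_\mu$. A solution $\mathbf P$ is strong if $\mathcal F^\eta_k\subset\mathcal F^\xi_k$ up to $\mathbf P$-null sets for every $k\in-\mathbf N$. Uniqueness in law holds if $\mathcal P_\mu$ consists of exactly one element. *)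

theory Defs
  imports "HOL-Probability.Probability"
begin

text \<open>
  Conventions.

  \<^item> A compact (Hausdorff) group is a type of class \<^class>\<open>topological_group_add\<close> and
    \<^class>\<open>t2_space\<close> whose universe is compact. That class is not commutative; it is merely
    written additively: \<open>x + y\<close> is the product $x \cdot y$, \<open>- x\<close> is the inverse of $x$, and
    \<open>0\<close> is the unit $e$.

  \<^item> The index \<open>n :: nat\<close> stands for the time $k = -n$. So \<open>w n\<close> is $\eta_{-n}$, time $k - 1$ has
    index \<open>Suc n\<close>, and the past of $k$ consists of the indices \<open>m \<ge> n\<close>.

  \<^item> The path space $G^{-N}$ is \<open>nat \<Rightarrow> 'a\<close> with the Borel sets of the product topology. If the
    group has a countable base, this is the product of the Borel sigma-algebras (lemma
    \<open>sets_PiM_equal_borel\<close>); in general, only the Borel sets of the product topology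
    are sure to make the increments \<open>xi n\<close> measurable.
\<close>

definition eta :: "nat \<Rightarrow> (nat \<Rightarrow> 'a) \<Rightarrow> 'a" where
  "eta n w = w n"

definition xi :: "nat \<Rightarrow> (nat \<Rightarrow> 'a::group_add) \<Rightarrow> 'a" where
  "xi n w = - eta (Suc n) w + eta n w"

lemma eta_step: "eta n w = eta (Suc n) w + xi n w"
  by (simp add: xi_def add.assoc [symmetric])

definition sigma_rv :: "((nat \<Rightarrow> 'a) \<Rightarrow> 'a::topological_space) \<Rightarrow> (nat \<Rightarrow> 'a) set set" where
  "sigma_rv X = {X -` A | A. A \<in> sets borel}"

definition past :: "(nat \<Rightarrow> (nat \<Rightarrow> 'a) \<Rightarrow> 'a::topological_space) \<Rightarrow> nat \<Rightarrow> (nat \<Rightarrow> 'a) set set" where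
  "past X n = sigma_sets UNIV (\<Union>m\<in>{n..}. sigma_rv (X m))"

definition noise_law :: "(nat \<Rightarrow> 'a::topological_space measure) \<Rightarrow> bool" where
  "noise_law \<mu> \<longleftrightarrow> (\<forall>n. prob_space (\<mu> n) \<and> sets (\<mu> n) = sets borel)"

definition solutions ::
  "(nat \<Rightarrow> 'a::topological_group_add measure) \<Rightarrow> (nat \<Rightarrow> 'a) measure set" where
  "solutions \<mu> = {P. prob_space P \<and> sets P = sets borel \<and>
     (\<forall>n. prob_space.indep_set P (sigma_rv (xi n)) (past eta (Suc n)) \<and>
          distr P borel (xi n) = \<mu> n)}"

definition strong :: "(nat \<Rightarrow> 'a::topological_group_add) measure \<Rightarrow> bool" where
  "strong P \<longleftrightarrow>
     (\<forall>n. \<forall>A\<in>past eta n. \<exists>B\<in>past xi n. sym_diff A B \<in> null_sets P)"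

definition uniqueness_in_law :: "(nat \<Rightarrow> 'a::topological_group_add measure) \<Rightarrow> bool" where
  "uniqueness_in_law \<mu> \<longleftrightarrow> (\<exists>!P. P \<in> solutions \<mu>)"

definition case_C0 :: "(nat \<Rightarrow> 'a::topological_group_add measure) \<Rightarrow> bool" where
  "case_C0 \<mu> \<longleftrightarrow> uniqueness_in_law \<mu> \<and> (\<exists>P\<in>solutions \<mu>. strong P)"

end

theory Submission
  imports Defs
begin

text \<open>
  The increments \<open>xi\<close> do not change when a whole path is multiplied on the left by one fixed
  \<open>g\<close>, so a left translate of a solution is again a solution (\<open>distr_translate_in_solutions\<close>).
  If the solution \<open>P\<close> is unique, it is therefore invariant under all left translations.
  If \<open>P\<close> is moreover strong, every event of the path agrees, up to a null set, with an event of
  the noise, and the latter is literally unchanged by translations. Hence every event of the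
  path is almost surely equal to each of its translates, and an event that is disjoint from one of
  its translates must be null (\<open>null_if_disjoint_translate\<close>).

  For \<open>g \<noteq> 0\<close> the Hausdorff property gives an open neighbourhood \<open>U\<close> of the unit that is
  disjoint from its translate by \<open>g\<close>, so the event that \<open>eta 0\<close> lies in \<open>U\<close> is null.
  By invariance the same holds for all translates of \<open>U\<close>, and by compactness finitely many of
  these cover the group: the whole space would be null.
\<close>

definition translate :: "'a::plus \<Rightarrow> (nat \<Rightarrow> 'a) \<Rightarrow> nat \<Rightarrow> 'a" where
  "translate g w = (\<lambda>n. g + w n)"

lemma xi_translate [simp]: "xi n (translate g w) = xi n w"
  by (simp add: xi_def eta_def translate_def minus_add add.assoc [symmetric])

lemma measurable_translate [measurable]:
  fixes g :: "'a::topological_group_add"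
  shows "translate g \<in> borel_measurable borel"
proof -
  have "continuous_on UNIV (translate g)"
    unfolding translate_def
    by (intro continuous_on_coordinatewise_then_product continuous_on_add continuous_on_const
        continuous_on_product_coordinates)
  then show ?thesis
    by (rule borel_measurable_continuous_onI)
qed

lemma measurable_eta [measurable]:
  "(eta n :: (nat \<Rightarrow> 'a::topological_space) \<Rightarrow> 'a) \<in> borel_measurable borel"
  unfolding eta_def
  by (intro borel_measurable_continuous_onI continuous_on_product_coordinates)

text \<open>
  Measurability is shown through continuity, because addition need not be measurable for the
  product of the Borel sigma-algebras when the group has no countable base.
\<close>

lemma measurable_xi [measurable]:
  "(xi n :: (nat \<Rightarrow> 'a::topological_group_add) \<Rightarrow> 'a) \<in> borel_measurable borel"
  unfolding xi_def eta_def
  by (intro borel_measurable_continuous_onI continuous_on_add continuous_on_minus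
      continuous_on_product_coordinates)

lemma sigma_rv_xi_translate:
  assumes "A \<in> sigma_rv (xi n)"
  shows "translate g -` A = A"
  using assms by (auto simp: sigma_rv_def)

lemma past_xi_translate:
  assumes "B \<in> past xi n"
  shows "translate g -` B = B"
  using assms unfolding past_def
proof (induction rule: sigma_sets.induct)
  case (Basic a)
  then show ?case using sigma_rv_xi_translate by blast
next
  case (Compl a)
  then show ?case by (simp add: vimage_Diff)
qed (simp_all add: vimage_UN)

lemma past_eta_translate:
  fixes g :: "'a::topological_group_add"
  assumes "A \<in> past eta n"
  shows "translate g -` A \<in> past eta n"
  using assms unfolding past_def
proof (induction rule: sigma_sets.induct)
  case (Basic a)
  then obtain m C where m: "m \<ge> n" and C: "C \<in> sets borel" and a: "a = eta m -` C"
    by (auto simp: sigma_rv_def)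
  have "(\<lambda>x. g + x) \<in> borel_measurable borel"
    by (intro borel_measurable_continuous_onI continuous_on_add continuous_on_const
        continuous_on_id)
  from measurable_sets[OF this C] have "(\<lambda>x. g + x) -` C \<in> sets borel"
    by simp
  moreover have "translate g -` a = eta m -` ((\<lambda>x. g + x) -` C)"
    by (auto simp: a eta_def translate_def)
  ultimately have "translate g -` a \<in> sigma_rv (eta m)"
    unfolding sigma_rv_def by blast
  with m show ?case by (intro sigma_sets.Basic) auto
next
  case Empty
  show ?case by (simp add: sigma_sets.Empty)
next
  case (Compl a)
  then show ?case by (simp add: vimage_Diff sigma_sets.Compl)
next
  case (Union a)
  then show ?case by (simp add: vimage_UN sigma_sets.Union)
qed

text \<open>
  The noise events are fixed by translations, and the events of the past of \<open>eta\<close> are permuted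
  among themselves; so independence and the noise law carry over.
\<close>

lemma distr_translate_in_solutions:
  fixes \<mu> :: "nat \<Rightarrow> 'a::topological_group_add measure"
  assumes P: "P \<in> solutions \<mu>"
  shows "distr P borel (translate g) \<in> solutions \<mu>"
proof -
  from P interpret prob_space P by (simp add: solutions_def)
  have sets_P: "sets P = sets borel"
    using P by (simp add: solutions_def)
  then have space_P: "space P = UNIV"
    by (metis sets_eq_imp_space_eq space_borel)
  have meas: "borel_measurable P = borel_measurable borel"
    by (intro measurable_cong_sets sets_P refl)
  have T: "translate g \<in> borel_measurable P"
    by (simp add: meas)
  let ?Q = "distr P borel (translate g)"
  interpret Q: prob_space ?Q
    by (rule prob_space_distr[OF T])
  have Q_prob: "Q.prob A = prob (translate g -` A)" if "A \<in> sets borel" for A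
    using that by (simp add: measure_distr[OF T] space_P)
  have "Q.indep_set (sigma_rv (xi n)) (past eta (Suc n))" for n
  proof -
    have ind: "indep_set (sigma_rv (xi n)) (past eta (Suc n))"
      using P by (simp add: solutions_def)
    then have "sigma_rv (xi n) \<subseteq> sets P" "past eta (Suc n) \<subseteq> sets P"
      unfolding indep_sets2_eq by blast+
    note sub = this[unfolded sets_P]
    show ?thesis
      unfolding Q.indep_sets2_eq
    proof (intro conjI ballI)
      fix A B :: "(nat \<Rightarrow> 'a) set"
      assume A: "A \<in> sigma_rv (xi n)" and B: "B \<in> past eta (Suc n)"
      have "Q.prob (A \<inter> B) = prob (A \<inter> translate g -` B)"
        using A B sub by (subst Q_prob) (auto simp: sigma_rv_xi_translate[OF A])
      also have "\<dots> = prob A * prob (translate g -` B)"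
        by (rule indep_setD[OF ind A past_eta_translate[OF B]])
      also have "\<dots> = Q.prob A * Q.prob B"
        using A B sub by (simp add: Q_prob subset_iff sigma_rv_xi_translate[OF A])
      finally show "Q.prob (A \<inter> B) = Q.prob A * Q.prob B" .
    qed (use sub in simp_all)
  qed
  moreover have "distr ?Q borel (xi n) = \<mu> n" for n
  proof -
    have "distr ?Q borel (xi n) = distr P borel (xi n \<circ> translate g)"
      by (rule distr_distr) (simp_all add: meas)
    also have "xi n \<circ> translate g = xi n"
      by auto
    also have "distr P borel (xi n) = \<mu> n"
      using P by (simp add: solutions_def)
    finally show ?thesis .
  qed
  ultimately show ?thesis
    by (simp add: solutions_def Q.prob_space_axioms)
qed

lemma null_sets_vimage_translate:
  fixes P :: "(nat \<Rightarrow> 'a::topological_group_add) measure"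
  assumes sets_P: "sets P = sets borel"
    and inv: "distr P borel (translate g) = P"
    and N: "N \<in> null_sets P"
  shows "translate g -` N \<in> null_sets P"
proof -
  have space_P: "space P = UNIV"
    using sets_P by (metis sets_eq_imp_space_eq space_borel)
  have "translate g \<in> measurable P borel"
    by (simp add: measurable_cong_sets[OF sets_P refl])
  from null_sets_distr_iff[OF this, of N, unfolded inv space_P Int_UNIV_right] N show ?thesis
    by blast
qed

text \<open>
  If \<open>B\<close> is a noise event that agrees with \<open>A\<close> almost surely, then it also agrees with the
  translate of \<open>A\<close>. An outcome in \<open>A\<close> is missed by \<open>B\<close>, or it lies in \<open>B\<close> but not in the
  translate of \<open>A\<close>; both have probability zero.
\<close>

lemma null_if_disjoint_translate:
  assumes sets_P: "sets P = sets borel"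
    and inv: "distr P borel (translate g) = P"
    and strong: "strong P"
    and A: "A \<in> past eta n" "A \<in> sets P"
    and disj: "A \<inter> translate g -` A = {}"
  shows "A \<in> null_sets P"
proof -
  from strong A obtain B where B: "B \<in> past xi n" and N: "sym_diff A B \<in> null_sets P"
    unfolding strong_def by blast
  have "translate g -` sym_diff A B \<in> null_sets P"
    by (rule null_sets_vimage_translate[OF sets_P inv N])
  then have "sym_diff (translate g -` A) B \<in> null_sets P"
    by (simp add: vimage_Un vimage_Diff past_xi_translate[OF B])
  with N have "sym_diff A B \<union> sym_diff (translate g -` A) B \<in> null_sets P"
    by (rule null_sets.Un)
  then show ?thesis
    by (rule null_sets_subset) (use A disj in auto)
qed

lemma open_disjoint_translate:
  fixes g :: "'a::{topological_group_add, t2_space}"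
  assumes "g \<noteq> 0"
  obtains U where "open U" "0 \<in> U" "\<And>x. x \<in> U \<Longrightarrow> g + x \<notin> U"
proof -
  from hausdorff[OF assms] obtain V W
    where V: "open V" "g \<in> V" and W: "open W" "0 \<in> W" and disj: "V \<inter> W = {}"
    by blast
  have "open ((\<lambda>x. g + x) -` V)"
    by (intro open_vimage V continuous_on_add continuous_on_const continuous_on_id)
  then show ?thesis
    using V W disj by (intro that[of "W \<inter> (\<lambda>x. g + x) -` V"]) auto
qed

lemma finite_translates_cover:
  fixes U :: "'a::topological_group_add set"
  assumes "compact (UNIV :: 'a set)" "open U" "0 \<in> U"
  obtains D where "finite D" "(\<Union>h\<in>D. (\<lambda>x. h + x) -` U) = UNIV"
proof -
  have "open ((\<lambda>x. h + x) -` U)" for h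
    by (intro open_vimage assms continuous_on_add continuous_on_const continuous_on_id)
  moreover have "x \<in> (\<lambda>y. - x + y) -` U" for x
    using assms by simp
  then have "UNIV \<subseteq> (\<Union>h. (\<lambda>x. h + x) -` U)"
    by blast
  ultimately obtain D where "finite D" "UNIV \<subseteq> (\<Union>h\<in>D. (\<lambda>x. h + x) -` U)"
    using compactE_image[OF assms(1), of UNIV "\<lambda>h. (\<lambda>x. h + x) -` U"] by auto
  then show ?thesis
    by (intro that[of D]) auto
qed

theorem corollary3p3:
  fixes \<mu> :: "nat \<Rightarrow> 'a::{topological_group_add, t2_space} measure"
  assumes compact: "compact (UNIV :: 'a set)"
    and nontrivial: "(UNIV :: 'a set) \<noteq> {0}"
    and noise: "noise_law \<mu>"
  shows "\<not> case_C0 \<mu>"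
proof
  assume "case_C0 \<mu>"
  then obtain P where P: "P \<in> solutions \<mu>" and strong: "strong P"
    and unique: "\<And>Q. Q \<in> solutions \<mu> \<Longrightarrow> Q = P"
    unfolding case_C0_def uniqueness_in_law_def by blast
  from P interpret prob_space P by (simp add: solutions_def)
  have sets_P: "sets P = sets borel"
    using P by (simp add: solutions_def)
  have inv: "distr P borel (translate h) = P" for h
    by (rule unique[OF distr_translate_in_solutions[OF P]])
  from nontrivial obtain g :: 'a where "g \<noteq> 0"
    by auto
  then obtain U where U: "open U" "0 \<in> U" "\<And>x. x \<in> U \<Longrightarrow> g + x \<notin> U"
    by (rule open_disjoint_translate) blast
  define A where "A = (eta 0 -` U :: (nat \<Rightarrow> 'a) set)"
  have "A \<in> sigma_rv (eta 0)"
    using U by (auto simp: A_def sigma_rv_def)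
  then have "A \<in> past eta 0"
    unfolding past_def by (intro sigma_sets.Basic) auto
  moreover have "A \<in> sets P"
    using measurable_sets[OF measurable_eta, of U 0] U by (simp add: A_def sets_P)
  moreover have "A \<inter> translate g -` A = {}"
    using U by (auto simp: A_def eta_def translate_def)
  ultimately have null: "A \<in> null_sets P"
    by (intro null_if_disjoint_translate[OF sets_P inv strong])
  obtain D where D: "finite D" "(\<Union>h\<in>D. (\<lambda>x. h + x) -` U) = UNIV"
    by (rule finite_translates_cover[OF compact U(1,2)])
  have "(\<Union>h\<in>D. translate h -` A) \<in> null_sets P"
    using D(1) by (intro null_sets.finite_UN null_sets_vimage_translate[OF sets_P inv null])
  also have "(\<Union>h\<in>D. translate h -` A) = eta 0 -` (\<Union>h\<in>D. (\<lambda>x. h + x) -` U)"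
    by (auto simp: A_def eta_def translate_def)
  also have "\<dots> = space P"
    using sets_eq_imp_space_eq[OF sets_P] by (simp add: D(2))
  finally show False
    by (simp add: null_sets_def emeasure_space_1)
qed

end
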